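(* Let $p,q\in[1,\infty]$ be such that $\tfrac1p+\tfrac1q=1$. The set of $\tilde P_c\in\mathbb R^n$ satisfying $$\big\|\big(\tfrac14[V_L^*]Y_{LL}[V_L^*]\big)^{-1}\big\|_q^\star\;\|\tilde P_c\|_p<1$$ is the open ball centered at $\mathbf 0$ $$\mathcal B=\{y\in\mathbb R^n:\|y\|_p<r\},\qquad r=\Big(\big\|\big(\tfrac14[V_L^*]Y_{LL}[V_L^*]\big)^{-1}\big\|_q^\star\Big)^{-1}>0,$$ and this radius $r$ is the largest scalar such that $$\big\|\big(\tfrac14[V_L^*]Y_{LL}[V_L^*]\big)^{-1}\tilde P_c\big\|_\infty<1$$ holds for all $\tilde P_c\in\mathcal B\cap\mathcal N$ (i.e., $r$ is the largest $\rho>0$ such that this inequality holds for all $\tilde P_c\ge\mathbf 0$ with $\|\tilde P_c\|_p<\rho$).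
   Context: Notation: $[x]=\operatorname{diag}(x_1,\dots,x_k)$ for a vector $x$; $\mathbf 0$ is the all-zeros vector; vector inequalities are element-wise; $\|\cdot\|_p$ is the $p$-norm on $\mathbb R^n$; $\tfrac1\infty=0$. For an $n\times n$ matrix $A$ and $p\in[1,\infty]$, $\|A\|_p^\star=\max_j\|A_{[j,\cdot]}\|_p$, where $A_{[j,\cdot]}$ is the $j$-th row of $A$. $\mathcal N=\{\nu\in\mathbb R^n:\nu\ge\mathbf 0\}$. Setting: a DC power grid with $n\ge1$ loads and $m\ge1$ sources. Its Kirchhoff matrix $Y=\begin{pmatrix} Y_{LL} & Y_{LS} \\ Y_{SL} & Y_{SS} \end{pmatrix}\in\mathbb R^{(n+m)\times(n+m)}$ is the weighted Laplacian of a connected undirected graph with positive edge weights (symmetric, nonpositive off-diagonal entries, zero row sums), partitioned according to loads and sources, and the $n\times n$ matrix $Y_{LL}$ is irreducible; hence $Y_{LL}$ is symmetric positive definite with nonpositive off-diagonal entries and has an entrywise positive inverse. The source voltages $V_S\in\mathbb R^m$, $V_S>\mathbf 0$, are fixed. Put $\mathcal I_L^*=-Y_{LS}V_S$ (which satisfies $\mathcal I_L^*\ge\mathbf 0$, $\mathcal I_L^*\ne\mathbf 0$) and $V_L^*=Y_{LL}^{-1}\mathcal I_L^*$ (which satisfies $V_L^*>\mathbf 0$). *)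

theory Defs
  imports "HOL-Analysis.Analysis"
begin

text \<open>A simple undirected graph on the vertex set \<open>UNIV :: 'v set\<close> is given by its set
  \<open>E\<close> of two-element edges; \<open>w e\<close> is the weight of the edge \<open>e\<close>.\<close>

definition connected_graph :: "'v set set \<Rightarrow> bool" where
  "connected_graph E \<longleftrightarrow> (\<forall>e\<in>E. card e = 2) \<and> (\<forall>u v. (u, v) \<in> {(a, b). {a, b} \<in> E}\<^sup>*)"

definition weighted_laplacian :: "'v::finite set set \<Rightarrow> ('v set \<Rightarrow> real) \<Rightarrow> real^'v^'v" where
  "weighted_laplacian E w = (\<chi> i j. if i = j then (\<Sum>e\<in>{e\<in>E. i \<in> e}. w e)
     else if {i, j} \<in> E then - w {i, j} else 0)"

definition kirchhoff_matrix :: "real^'v::finite^'v \<Rightarrow> bool" where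
  "kirchhoff_matrix Y \<longleftrightarrow>
     (\<exists>E w. connected_graph E \<and> (\<forall>e\<in>E. 0 < w e) \<and> Y = weighted_laplacian E w)"

lemma kirchhoff_matrix_symmetric: "kirchhoff_matrix Y \<Longrightarrow> transpose Y = Y"
  by (auto simp: kirchhoff_matrix_def weighted_laplacian_def transpose_def vec_eq_iff insert_commute)

lemma kirchhoff_matrix_off_diagonal: "kirchhoff_matrix Y \<Longrightarrow> i \<noteq> j \<Longrightarrow> Y $ i $ j \<le> 0"
  by (force simp: kirchhoff_matrix_def weighted_laplacian_def)

lemma kirchhoff_matrix_row_sum:
  assumes "kirchhoff_matrix Y"
  shows "(\<Sum>j\<in>UNIV. Y $ i $ j) = 0"
proof -
  obtain E w where E: "connected_graph E" and Y: "Y = weighted_laplacian E w"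
    using assms by (auto simp: kirchhoff_matrix_def)
  let ?N = "{j. j \<noteq> i \<and> {i, j} \<in> E}"
  have "bij_betw (\<lambda>j. {i, j}) ?N {e\<in>E. i \<in> e}"
  proof (rule bij_betwI')
    fix e assume "e \<in> {e\<in>E. i \<in> e}"
    then have "card e = 2" "i \<in> e" "e \<in> E" using E by (auto simp: connected_graph_def)
    then show "\<exists>j\<in>?N. e = {i, j}" by (auto simp: card_2_iff insert_commute)
  qed (auto simp: doubleton_eq_iff)
  then have "(\<Sum>e\<in>{e\<in>E. i \<in> e}. w e) = (\<Sum>j\<in>?N. w {i, j})"
    by (rule sum.reindex_bij_betw[symmetric])
  also have "\<dots> = (\<Sum>j\<in>UNIV - {i}. if {i, j} \<in> E then w {i, j} else 0)"
    by (rule sum.mono_neutral_cong_left) auto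
  also have "\<dots> = - (\<Sum>j\<in>UNIV - {i}. Y $ i $ j)"
    unfolding sum_negf[symmetric] by (rule sum.cong) (auto simp: Y weighted_laplacian_def)
  finally show ?thesis
    by (simp add: Y weighted_laplacian_def sum.remove[of UNIV i])
qed

text \<open>Nodes are indexed by the sum type \<open>'n + 'm\<close>: \<open>Inl\<close> for loads, \<open>Inr\<close> for sources.\<close>

definition block_LL :: "real^('n::finite + 'm::finite)^('n + 'm) \<Rightarrow> real^'n^'n" where
  "block_LL Y = (\<chi> i j. Y $ Inl i $ Inl j)"

definition block_LS :: "real^('n::finite + 'm::finite)^('n + 'm) \<Rightarrow> real^'m^'n" where
  "block_LS Y = (\<chi> i j. Y $ Inl i $ Inr j)"

text \<open>Irreducible: no simultaneous row and column permutation brings \<open>A\<close> into block triangular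
  form with two nonempty diagonal blocks. Every \<open>1 \<times> 1\<close> matrix is irreducible.\<close>

definition irreducible_matrix :: "real^'n^'n \<Rightarrow> bool" where
  "irreducible_matrix A \<longleftrightarrow>
     \<not> (\<exists>S. S \<noteq> {} \<and> S \<noteq> UNIV \<and> (\<forall>i\<in>S. \<forall>j\<in>- S. A $ i $ j = 0))"

definition diag_matrix :: "real^'n \<Rightarrow> real^'n^'n" where
  "diag_matrix x = (\<chi> i j. if i = j then x $ i else 0)"

definition pnorm :: "ereal \<Rightarrow> real^'n \<Rightarrow> real" where
  "pnorm p x = (if p = \<infinity> then infnorm x
     else (\<Sum>i\<in>UNIV. \<bar>x $ i\<bar> powr real_of_ereal p) powr (1 / real_of_ereal p))"

definition row_pnorm :: "ereal \<Rightarrow> real^'n^'n \<Rightarrow> real" where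
  "row_pnorm p A = Max (range (\<lambda>j. pnorm p (row j A)))"

definition I_L_star :: "real^('n::finite + 'm::finite)^('n + 'm) \<Rightarrow> real^'m \<Rightarrow> real^'n" where
  "I_L_star Y V_S = - (block_LS Y *v V_S)"

definition V_L_star :: "real^('n::finite + 'm::finite)^('n + 'm) \<Rightarrow> real^'m \<Rightarrow> real^'n" where
  "V_L_star Y V_S = matrix_inv (block_LL Y) *v I_L_star Y V_S"

end

theory Submission
  imports Defs
begin

text \<open>The matrix \<open>M\<close> has nonnegative entries and no zero row: the minimum principle for the
  Kirchhoff matrix makes \<open>Y_LL\<close> inverse-nonnegative and \<open>V_L\<^sup>*\<close> positive, and both survive the
  positive diagonal scaling. Hoelder's inequality on each row bounds the infinity norm of \<open>M P\<close>
  by \<open>1 / r\<close> times the p-norm of \<open>P\<close>. For a row of maximal q-norm the extremal vector in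
  Hoelder's inequality can be taken nonnegative because the row is, so the bound is attained
  inside the nonnegative orthant.\<close>

section \<open>Duality of the p-norms\<close>

text \<open>The endpoint pairs are split off because the norms and the extremal vectors take another
  form there; every other pair consists of real exponents greater than 1.\<close>

lemma conjugate_exponents_cases:
  fixes p q :: ereal
  assumes "1 \<le> p" "1 \<le> q" "1 / p + 1 / q = 1"
  obtains (one_infty) "p = 1" "q = \<infinity>"
  | (infty_one) "p = \<infinity>" "q = 1"
  | (finite) s t where "p = ereal s" "q = ereal t" "1 < s" "1 < t" "1 / s + 1 / t = 1"
proof (cases p)
  case (real s)
  show ?thesis
  proof (cases q)
    case (real t)
    have st: "1 \<le> s" "1 \<le> t" "1 / s + 1 / t = 1"
      using assms \<open>p = ereal s\<close> real by (auto simp: one_ereal_def)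
    \<comment> \<open>An exponent 1 would force the other reciprocal to be 0, impossible for a real
      exponent at least 1.\<close>
    then have "s \<noteq> 1" "t \<noteq> 1" by auto
    with st show ?thesis using finite \<open>p = ereal s\<close> real by simp
  next
    case PInf
    then have "1 / s = 1" using assms real by (auto simp: one_ereal_def split: if_splits)
    then show ?thesis using one_infty real PInf by (auto simp: one_ereal_def divide_simps split: if_splits)
  qed (use assms in auto)
next
  case PInf
  show ?thesis
  proof (cases q)
    case (real t)
    then have "1 / t = 1" using assms PInf by (auto simp: one_ereal_def split: if_splits)
    then show ?thesis using infty_one real PInf by (auto simp: one_ereal_def divide_simps split: if_splits)
  qed (use assms PInf in auto)
qed (use assms in auto)

lemma pnorm_infty [simp]: "pnorm \<infinity> x = infnorm x"
  by (simp add: pnorm_def)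

lemma pnorm_one [simp]: "pnorm 1 x = (\<Sum>i\<in>UNIV. \<bar>x $ i\<bar>)"
  by (simp add: pnorm_def sum_nonneg)

lemma pnorm_ereal: "pnorm (ereal s) x = (\<Sum>i\<in>UNIV. \<bar>x $ i\<bar> powr s) powr (1 / s)"
  by (simp add: pnorm_def)

lemma pnorm_nonneg: "0 \<le> pnorm p x"
  by (simp add: pnorm_def infnorm_pos_le)

lemma sum_abs_powr_pos:
  fixes x :: "real^'n"
  assumes "x \<noteq> 0"
  shows "0 < (\<Sum>i\<in>UNIV. \<bar>x $ i\<bar> powr s)"
proof -
  obtain i where "x $ i \<noteq> 0" using assms by (auto simp: vec_eq_iff)
  then show ?thesis by (intro sum_pos2[of _ i]) auto
qed

lemma pnorm_pos:
  fixes x :: "real^'n"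
  assumes "x \<noteq> 0"
  shows "0 < pnorm p x"
  using sum_abs_powr_pos[OF assms, of "real_of_ereal p"] assms
  by (simp add: pnorm_def infnorm_pos_lt)

lemma pnorm_scaleR:
  assumes "1 \<le> p"
  shows "pnorm p (c *\<^sub>R x) = \<bar>c\<bar> * pnorm p x"
proof (cases p)
  case (real s)
  then have s: "1 \<le> s" using assms by (simp add: one_ereal_def)
  have "(\<Sum>i\<in>UNIV. \<bar>(c *\<^sub>R x) $ i\<bar> powr s) = \<bar>c\<bar> powr s * (\<Sum>i\<in>UNIV. \<bar>x $ i\<bar> powr s)"
    by (simp add: abs_mult powr_mult sum_distrib_left)
  then show ?thesis using s
    by (simp add: real pnorm_ereal powr_mult powr_powr sum_nonneg)
qed (use assms in \<open>auto simp: infnorm_mul\<close>)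

lemma infnorm_attained:
  fixes x :: "real^'n"
  obtains i where "infnorm x = \<bar>x $ i\<bar>"
proof -
  have "infnorm x = Max (range (\<lambda>i. \<bar>x $ i\<bar>))"
    unfolding infnorm_cart by (subst cSup_eq_Max[symmetric]) (auto simp: full_SetCompr_eq)
  then have "infnorm x \<in> range (\<lambda>i. \<bar>x $ i\<bar>)"
    by (metis Max_in UNIV_not_empty finite finite_imageI image_is_empty)
  then show ?thesis using that by auto
qed

lemma abs_inner_le_one_infty:
  fixes a x :: "real^'n"
  shows "\<bar>a \<bullet> x\<bar> \<le> (\<Sum>i\<in>UNIV. \<bar>a $ i\<bar>) * infnorm x"
proof -
  have "\<bar>a \<bullet> x\<bar> \<le> (\<Sum>i\<in>UNIV. \<bar>a $ i * x $ i\<bar>)"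
    by (simp add: inner_vec_def)
  also have "\<dots> \<le> (\<Sum>i\<in>UNIV. \<bar>a $ i\<bar> * infnorm x)"
    by (intro sum_mono) (simp add: abs_mult mult_left_mono component_le_infnorm_cart)
  finally show ?thesis by (simp add: sum_distrib_right)
qed

text \<open>For real exponents both vectors are scaled to norm 1 and Young's inequality is summed
  over the components.\<close>

lemma Holder_pnorm:
  fixes a x :: "real^'n"
  assumes p: "1 \<le> p" and q: "1 \<le> q" and pq: "1 / p + 1 / q = 1"
  shows "\<bar>a \<bullet> x\<bar> \<le> pnorm q a * pnorm p x"
  using p q pq
proof (cases rule: conjugate_exponents_cases)
  case one_infty
  then show ?thesis using abs_inner_le_one_infty[of x a] by (simp add: inner_commute mult.commute)
next
  case infty_one
  then show ?thesis using abs_inner_le_one_infty[of a x] by simp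
next
  case (finite s t)
  show ?thesis
  proof (cases "a = 0 \<or> x = 0")
    case True
    then show ?thesis by (elim disjE) (simp_all add: pnorm_nonneg)
  next
    case False
    define A where "A = pnorm q a"
    define B where "B = pnorm p x"
    have pos: "0 < A" "0 < B" using False by (auto simp: A_def B_def pnorm_pos)
    have A: "A powr t = (\<Sum>i\<in>UNIV. \<bar>a $ i\<bar> powr t)" and B: "B powr s = (\<Sum>i\<in>UNIV. \<bar>x $ i\<bar> powr s)"
      using finite by (simp_all add: A_def B_def pnorm_ereal powr_powr sum_nonneg)
    have "\<bar>a \<bullet> x\<bar> / (A * B) \<le> (\<Sum>i\<in>UNIV. (\<bar>a $ i\<bar> / A) * (\<bar>x $ i\<bar> / B))"
      using pos by (simp add: inner_vec_def sum_divide_distrib[symmetric] divide_right_mono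
          abs_mult[symmetric])
    also have "\<dots> \<le> (\<Sum>i\<in>UNIV. (\<bar>a $ i\<bar> / A) powr t / t + (\<bar>x $ i\<bar> / B) powr s / s)"
      using finite pos by (intro sum_mono Youngs_inequality) auto
    also have "\<dots> = (\<Sum>i\<in>UNIV. \<bar>a $ i\<bar> powr t) / A powr t / t + (\<Sum>i\<in>UNIV. \<bar>x $ i\<bar> powr s) / B powr s / s"
      using pos by (simp add: sum.distrib powr_divide sum_divide_distrib)
    \<comment> \<open>Each normalised sum of powers equals 1, which leaves 1/t + 1/s.\<close>
    also have "\<dots> = 1"
      using finite pos unfolding A[symmetric] B[symmetric] by simp
    finally show ?thesis using pos by (simp add: A_def B_def divide_le_eq)
  qed
qed

text \<open>Equality for any nonzero nonnegative vector suffices, since dividing that vector by its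
  p-norm keeps the equality and the sign.\<close>

lemma Holder_pnorm_attained:
  fixes a :: "real^'n"
  assumes p: "1 \<le> p" and q: "1 \<le> q" and pq: "1 / p + 1 / q = 1" and a: "0 \<le> a" "a \<noteq> 0"
  obtains x where "0 \<le> x" "pnorm p x = 1" "a \<bullet> x = pnorm q a"
proof -
  have a_nonneg: "0 \<le> a $ i" for i using a by (simp add: less_eq_vec_def)
  have "\<exists>x. 0 \<le> x \<and> x \<noteq> 0 \<and> a \<bullet> x = pnorm q a * pnorm p x"
    using p q pq
  proof (cases rule: conjugate_exponents_cases)
    case one_infty
    \<comment> \<open>The extremal vector puts all its mass on one coordinate where \<open>a\<close>
      is largest.\<close>
    obtain i where "infnorm a = \<bar>a $ i\<bar>" by (rule infnorm_attained)
    moreover have "0 \<le> axis i (1::real)" by (simp add: less_eq_vec_def axis_def)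
    moreover have "(\<Sum>j\<in>UNIV. \<bar>axis i (1::real) $ j\<bar>) = 1"
      by (simp add: axis_def if_distrib[of abs] cong: if_cong)
    ultimately show ?thesis using one_infty a_nonneg
      by (intro exI[of _ "axis i 1"]) (simp add: inner_axis)
  next
    case infty_one
    \<comment> \<open>The all-ones vector has infinity norm 1 and sums up the entries of
      \<open>a\<close>.\<close>
    obtain i where "infnorm (1 :: real^'n) = \<bar>(1 :: real^'n) $ i\<bar>" by (rule infnorm_attained)
    then show ?thesis using infty_one a_nonneg
      by (intro exI[of _ 1]) (auto simp: inner_vec_def less_eq_vec_def vec_eq_iff)
  next
    case (finite s t)
    define S where "S = (\<Sum>i\<in>UNIV. \<bar>a $ i\<bar> powr t)"
    \<comment> \<open>Young's inequality is an equality when the \<open>s\<close>-th powers of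
      \<open>x\<close> match the \<open>t\<close>-th powers of \<open>a\<close>; conjugacy turns the
      exponent t/s into t - 1.\<close>
    define x :: "real^'n" where "x = (\<chi> i. a $ i powr (t - 1))"
    have "0 < S" unfolding S_def using a by (intro sum_abs_powr_pos)
    have ts: "(t - 1) * s = t" using finite by (simp add: field_simps)
    have "a $ i * a $ i powr (t - 1) = a $ i powr t" for i
      using a_nonneg[of i] powr_add[of "a $ i" 1 "t - 1"] by simp
    then have "a \<bullet> x = S"
      by (simp add: inner_vec_def x_def S_def a_nonneg)
    \<comment> \<open>Conjugacy splits the exponent 1 into 1/t + 1/s, one root for each
      norm.\<close>
    also have "\<dots> = S powr (1 / t) * S powr (1 / s)"
      using \<open>0 < S\<close> finite by (simp add: powr_add[symmetric] add.commute)
    also have "\<dots> = pnorm q a * pnorm p x"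
      using finite ts by (simp add: pnorm_ereal S_def x_def powr_powr a_nonneg)
    finally have eq: "a \<bullet> x = pnorm q a * pnorm p x" .
    have "x \<noteq> 0" using \<open>a \<bullet> x = S\<close> \<open>0 < S\<close> by auto
    then show ?thesis using eq by (intro exI[of _ x]) (auto simp: x_def less_eq_vec_def)
  qed
  then obtain x where x: "0 \<le> x" "x \<noteq> 0" "a \<bullet> x = pnorm q a * pnorm p x" by blast
  have pos: "0 < pnorm p x" using x by (intro pnorm_pos)
  show ?thesis
  proof
    show "0 \<le> inverse (pnorm p x) *\<^sub>R x" using x pos by (auto simp: less_eq_vec_def)
    show "pnorm p (inverse (pnorm p x) *\<^sub>R x) = 1" using pos p by (simp add: pnorm_scaleR)
    show "a \<bullet> (inverse (pnorm p x) *\<^sub>R x) = pnorm q a" using x pos by simp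
  qed
qed

section \<open>The sharp bound on the image of the nonnegative part of a ball\<close>

lemma pnorm_row_le: "pnorm q (row j A) \<le> row_pnorm q A"
  by (auto simp: row_pnorm_def)

lemma row_pnorm_attained:
  fixes A :: "real^'n^'n"
  obtains j where "row_pnorm q A = pnorm q (row j A)"
proof -
  have "row_pnorm q A \<in> range (\<lambda>j. pnorm q (row j A))"
    unfolding row_pnorm_def by (rule Max_in) auto
  then show ?thesis using that by auto
qed

lemma row_eq_nth: "row j A = A $ j"
  by (simp add: row_def vec_eq_iff)

lemma row_pnorm_pos:
  fixes A :: "real^'n^'n"
  assumes "\<And>j. row j A \<noteq> 0"
  shows "0 < row_pnorm q A"
  using row_pnorm_attained[of q A] pnorm_pos[OF assms, of q] by metis

lemma infnorm_matrix_vector_mult_le: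
  fixes A :: "real^'n^'n"
  assumes "1 \<le> p" "1 \<le> q" "1 / p + 1 / q = 1"
  shows "infnorm (A *v x) \<le> row_pnorm q A * pnorm p x"
proof -
  obtain i where "infnorm (A *v x) = \<bar>(A *v x) $ i\<bar>" by (rule infnorm_attained)
  also have "\<dots> = \<bar>row i A \<bullet> x\<bar>" by (simp add: matrix_vector_mul_component row_eq_nth)
  also have "\<dots> \<le> pnorm q (row i A) * pnorm p x" by (rule Holder_pnorm[OF assms])
  also have "\<dots> \<le> row_pnorm q A * pnorm p x"
    by (intro mult_right_mono pnorm_row_le pnorm_nonneg)
  finally show ?thesis .
qed

lemma infnorm_matrix_vector_mult_attained:
  fixes A :: "real^'n^'n"
  assumes pq: "1 \<le> p" "1 \<le> q" "1 / p + 1 / q = 1"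
    and A: "\<And>j. 0 \<le> row j A" "\<And>j. row j A \<noteq> 0"
  obtains x where "0 \<le> x" "pnorm p x = 1" "row_pnorm q A \<le> infnorm (A *v x)"
proof -
  obtain j where j: "row_pnorm q A = pnorm q (row j A)" by (rule row_pnorm_attained)
  obtain x where x: "0 \<le> x" "pnorm p x = 1" "row j A \<bullet> x = pnorm q (row j A)"
    using Holder_pnorm_attained[OF pq A] .
  have "(A *v x) $ j = row_pnorm q A"
    using x j by (simp add: matrix_vector_mul_component row_eq_nth)
  then have "row_pnorm q A \<le> infnorm (A *v x)"
    using component_le_infnorm_cart[of "A *v x" j] by simp
  with x show ?thesis using that by blast
qed

lemma ball_pnorm_sharp:
  fixes A :: "real^'n^'n"
  assumes pq: "1 \<le> p" "1 \<le> q" "1 / p + 1 / q = 1"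
    and A: "\<And>j. 0 \<le> row j A" "\<And>j. row j A \<noteq> 0"
  defines "r \<equiv> inverse (row_pnorm q A)"
  shows "{P :: real^'n. row_pnorm q A * pnorm p P < 1} = {y. pnorm p y < r}
    \<and> r > 0
    \<and> (\<forall>P. 0 \<le> P \<and> pnorm p P < r \<longrightarrow> infnorm (A *v P) < 1)
    \<and> (\<forall>\<rho>>0. (\<forall>P. 0 \<le> P \<and> pnorm p P < \<rho> \<longrightarrow> infnorm (A *v P) < 1) \<longrightarrow> \<rho> \<le> r)"
proof (intro conjI)
  have N: "0 < row_pnorm q A" by (rule row_pnorm_pos[OF A(2)])
  then show r: "r > 0" by (simp add: r_def)
  have iff: "row_pnorm q A * pnorm p P < 1 \<longleftrightarrow> pnorm p P < r" for P :: "real^'n"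
    using N by (simp add: r_def field_simps)
  then show "{P :: real^'n. row_pnorm q A * pnorm p P < 1} = {y. pnorm p y < r}" by simp
  show "\<forall>P. 0 \<le> P \<and> pnorm p P < r \<longrightarrow> infnorm (A *v P) < 1"
    using infnorm_matrix_vector_mult_le[OF pq, of A] iff le_less_trans by blast
  show "\<forall>\<rho>>0. (\<forall>P. 0 \<le> P \<and> pnorm p P < \<rho> \<longrightarrow> infnorm (A *v P) < 1) \<longrightarrow> \<rho> \<le> r"
  proof (intro allI impI)
    fix \<rho> assume \<rho>: "\<forall>P. 0 \<le> P \<and> pnorm p P < \<rho> \<longrightarrow> infnorm (A *v P) < 1"
    obtain x where x: "0 \<le> x" "pnorm p x = 1" "row_pnorm q A \<le> infnorm (A *v x)"
      using infnorm_matrix_vector_mult_attained[OF pq A] .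
    \<comment> \<open>The extremal unit vector scaled to norm \<open>r\<close> violates the strict
      bound, so no ball of larger radius qualifies.\<close>
    have "1 \<le> infnorm (A *v (r *\<^sub>R x))"
      using x(3) r N by (simp add: matrix_vector_mult_scaleR infnorm_mul r_def field_simps)
    moreover have "0 \<le> r *\<^sub>R x" using x(1) r by (simp add: less_eq_vec_def)
    moreover have "pnorm p (r *\<^sub>R x) = r" using x(2) r pq(1) by (simp add: pnorm_scaleR)
    ultimately show "\<rho> \<le> r" using \<rho> by (metis not_le)
  qed
qed

section \<open>Inverse-nonnegative matrices\<close>

text \<open>Monotone matrices in the sense of Collatz: equivalent to being invertible with an
  entrywise nonnegative inverse, but phrased without the inverse so that a minimum principle yields
  it directly.\<close>

definition inverse_nonneg :: "real^'n^'n \<Rightarrow> bool" where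
  "inverse_nonneg A \<longleftrightarrow> (\<forall>z. 0 \<le> A *v z \<longrightarrow> 0 \<le> z)"

lemma invertible_matrix_inv:
  assumes "invertible A"
  shows "A ** matrix_inv A = mat 1" "matrix_inv A ** A = mat 1"
  using someI_ex[OF assms[unfolded invertible_def]] by (simp_all add: matrix_inv_def)

text \<open>A kernel vector and its negative are both nonnegative, so the kernel is trivial.\<close>

lemma inverse_nonneg_invertible:
  assumes "inverse_nonneg A"
  shows "invertible A"
proof -
  have "x = 0" if "A *v x = 0" for x
  proof -
    have "A *v (- x) = 0" using that matrix_vector_mult_diff_distrib[of A 0 x] by simp
    then have "0 \<le> x" "0 \<le> - x"
      using assms that unfolding inverse_nonneg_def by (metis order_refl)+
    then show ?thesis by (simp add: less_eq_vec_def vec_eq_iff order_antisym)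
  qed
  then show ?thesis
    by (simp add: invertible_left_inverse matrix_left_invertible_ker)
qed

text \<open>Column \<open>k\<close> of the inverse solves a system whose right-hand side is the
  nonnegative vector \<open>axis k 1\<close>.\<close>

lemma inverse_nonneg_rows:
  fixes A :: "real^'n^'n"
  assumes "inverse_nonneg A"
  shows "0 \<le> row j (matrix_inv A)" "row j (matrix_inv A) \<noteq> 0"
proof -
  have inv: "A ** matrix_inv A = mat 1" "matrix_inv A ** A = mat 1"
    using inverse_nonneg_invertible[OF assms] by (simp_all add: invertible_matrix_inv)
  have "0 \<le> matrix_inv A *v axis k 1" for k
  proof -
    have "A *v (matrix_inv A *v axis k 1) = axis k 1"
      by (simp add: matrix_vector_mul_assoc inv)
    then show ?thesis
      using assms by (auto simp: inverse_nonneg_def less_eq_vec_def axis_def)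
  qed
  then show "0 \<le> row j (matrix_inv A)"
    by (simp add: less_eq_vec_def row_def matrix_vector_mul_component inner_axis)
  show "row j (matrix_inv A) \<noteq> 0"
  proof
    assume "row j (matrix_inv A) = 0"
    \<comment> \<open>The same entry is a diagonal entry of the identity, hence 1.\<close>
    then have "(matrix_inv A *v (A *v axis j 1)) $ j = 0"
      by (simp add: matrix_vector_mul_component row_eq_nth)
    then show False by (simp add: matrix_vector_mul_assoc inv)
  qed
qed

lemma diag_matrix_mult_component: "(diag_matrix x *v z) $ i = x $ i * z $ i"
  by (simp add: diag_matrix_def matrix_vector_mult_def if_distrib[of "\<lambda>c. c * _"] cong: if_cong)

text \<open>Positive scalars and positive diagonal factors reflect nonnegativity, so the factors are
  peeled off one at a time.\<close>

lemma inverse_nonneg_diag_scale: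
  assumes A: "inverse_nonneg A" and x: "\<And>i. 0 < x $ i" and c: "0 < c"
  shows "inverse_nonneg (c *\<^sub>R (diag_matrix x ** A ** diag_matrix x))"
  unfolding inverse_nonneg_def
proof (intro allI impI)
  fix z assume "0 \<le> (c *\<^sub>R (diag_matrix x ** A ** diag_matrix x)) *v z"
  then have "0 \<le> diag_matrix x *v (A *v (diag_matrix x *v z))"
    using c by (simp add: less_eq_vec_def scaleR_matrix_vector_assoc[symmetric]
        matrix_vector_mul_assoc matrix_mul_assoc zero_le_mult_iff)
  then have "0 \<le> A *v (diag_matrix x *v z)"
    using x by (simp add: less_eq_vec_def diag_matrix_mult_component zero_le_mult_iff not_le[symmetric])
  then have "0 \<le> diag_matrix x *v z" using A by (simp add: inverse_nonneg_def)
  then show "0 \<le> z"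
    using x by (simp add: less_eq_vec_def diag_matrix_mult_component zero_le_mult_iff not_le[symmetric])
qed

section \<open>The minimum principle for Kirchhoff matrices\<close>

text \<open>Connectedness as a closure principle: membership in \<open>S\<close> propagates along
  the edges of a path from \<open>u\<close>.\<close>

lemma kirchhoff_matrix_connected:
  assumes Y: "kirchhoff_matrix Y" and "u \<in> S"
    and closed: "\<And>i j. i \<in> S \<Longrightarrow> Y $ i $ j \<noteq> 0 \<Longrightarrow> j \<in> S"
  shows "S = UNIV"
proof -
  obtain E w where E: "connected_graph E" and w: "\<forall>e\<in>E. 0 < w e" and Yw: "Y = weighted_laplacian E w"
    using Y by (auto simp: kirchhoff_matrix_def)
  have "v \<in> S" for v
  proof -
    have "(u, v) \<in> {(a, b). {a, b} \<in> E}\<^sup>*" using E by (simp add: connected_graph_def)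
    then show ?thesis
    proof (induction rule: rtrancl_induct)
      case (step y z)
      then have e: "{y, z} \<in> E" by simp
      \<comment> \<open>An edge has two distinct ends, so the entry is off-diagonal and equals the
        negated positive weight.\<close>
      with E have "y \<noteq> z" by (auto simp: connected_graph_def)
      with e w have "Y $ y $ z \<noteq> 0" by (force simp: Yw weighted_laplacian_def)
      with step closed show ?case by blast
    qed (use \<open>u \<in> S\<close> in simp)
  qed
  then show ?thesis by blast
qed

text \<open>Where \<open>Y x \<ge> 0\<close>, the value of \<open>x\<close> is at least a weighted average of the neighbouring
  values, so the set of minimisers can only stop propagating at a source.\<close>

lemma kirchhoff_minimum_at_source:
  fixes x :: "real^('n::finite + 'm::finite)"
  assumes Y: "kirchhoff_matrix Y" and x: "\<And>i. 0 \<le> (Y *v x) $ Inl i"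
  shows "\<exists>k. \<forall>v. x $ Inr k \<le> x $ v"
proof -
  define m where "m = Min (range (($) x))"
  have m_le: "m \<le> x $ v" for v by (simp add: m_def)
  define S where "S = {v. x $ v = m}"
  have "m \<in> range (($) x)" unfolding m_def by (rule Min_in) auto
  then obtain u where u: "u \<in> S" by (auto simp: S_def)
  have "\<exists>k. Inr k \<in> S"
  proof (rule ccontr)
    assume no: "\<nexists>k. Inr k \<in> S"
    have "j \<in> S" if "i \<in> S" and Yij: "Y $ i $ j \<noteq> 0" for i j
    proof -
      obtain l where l: "i = Inl l" using no \<open>i \<in> S\<close> by (cases i) auto
      \<comment> \<open>The diagonal term vanishes because \<open>i\<close> is a minimiser; off the
        diagonal the two factors have opposite signs.\<close>
      have le0: "Y $ i $ k * (x $ k - m) \<le> 0" for k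
        using kirchhoff_matrix_off_diagonal[OF Y, of i k] m_le[of k] \<open>i \<in> S\<close>
        by (cases "k = i") (auto simp: S_def mult_le_0_iff)
      \<comment> \<open>Zero row sums allow the constant \<open>m\<close> to be subtracted.\<close>
      have "(Y *v x) $ i = (\<Sum>k\<in>UNIV. Y $ i $ k * (x $ k - m))"
        using kirchhoff_matrix_row_sum[OF Y, of i]
        by (simp add: matrix_vector_mult_def right_diff_distrib sum_subtractf sum_distrib_right[symmetric])
      then have "0 \<le> (\<Sum>k\<in>UNIV. Y $ i $ k * (x $ k - m))" using x[of l] l by simp
      \<comment> \<open>Nonpositive terms with a nonnegative sum must all vanish, so every neighbour
        of \<open>i\<close> is a minimiser too.\<close>
      then have "(\<Sum>k\<in>UNIV. - (Y $ i $ k * (x $ k - m))) = 0"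
        using le0 by (simp add: sum_negf sum_nonpos antisym)
      then have "Y $ i $ j * (x $ j - m) = 0"
        using le0 by (subst (asm) sum_nonneg_eq_0_iff) auto
      then show ?thesis using Yij by (simp add: S_def)
    qed
    then have "S = UNIV" by (rule kirchhoff_matrix_connected[OF Y u])
    then show False using no by auto
  qed
  then show ?thesis using m_le by (auto simp: S_def)
qed

text \<open>Load and source voltages stacked into one vector over all nodes, to which the minimum
  principle applies.\<close>

definition join :: "real^'n \<Rightarrow> real^'m \<Rightarrow> real^('n::finite + 'm::finite)" where
  "join a b = (\<chi> v. case v of Inl i \<Rightarrow> a $ i | Inr k \<Rightarrow> b $ k)"

lemma join_nth [simp]: "join a b $ Inl i = a $ i" "join a b $ Inr k = b $ k"
  by (simp_all add: join_def)

lemma mult_join_Inl: "(Y *v join a b) $ Inl i = (block_LL Y *v a + block_LS Y *v b) $ i"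
  by (simp add: matrix_vector_mult_def block_LL_def block_LS_def UNIV_Plus_UNIV[symmetric]
      sum.Plus del: UNIV_Plus_UNIV)

text \<open>Extending \<open>z\<close> by 0 at the sources makes the minimum over all nodes equal to
  0.\<close>

lemma inverse_nonneg_block_LL:
  fixes Y :: "real^('n::finite + 'm::finite)^('n + 'm)"
  assumes Y: "kirchhoff_matrix Y"
  shows "inverse_nonneg (block_LL Y)"
  unfolding inverse_nonneg_def
proof (intro allI impI)
  fix z assume "0 \<le> block_LL Y *v z"
  then have "\<And>i. 0 \<le> (Y *v join z 0) $ Inl i" by (simp add: mult_join_Inl less_eq_vec_def)
  from kirchhoff_minimum_at_source[OF Y this] obtain k where k: "\<forall>v. join z (0 :: real^'m) $ Inr k \<le> join z (0 :: real^'m) $ v"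
    by blast
  have "0 \<le> z $ i" for i using k[rule_format, of "Inl i"] by simp
  then show "0 \<le> z" by (simp add: less_eq_vec_def)
qed

text \<open>By the choice of \<open>V_L_star\<close> the load components of \<open>Y\<close> applied
  to the joint voltage vector vanish, so its minimum is one of the positive source voltages.\<close>

lemma V_L_star_pos:
  fixes Y :: "real^('n::finite + 'm::finite)^('n + 'm)"
  assumes Y: "kirchhoff_matrix Y" and V: "\<And>j. 0 < V_S $ j"
  shows "0 < V_L_star Y V_S $ i"
proof -
  have "block_LL Y ** matrix_inv (block_LL Y) = mat 1"
    using inverse_nonneg_invertible[OF inverse_nonneg_block_LL[OF Y]] by (rule invertible_matrix_inv)
  then have "block_LL Y *v V_L_star Y V_S = I_L_star Y V_S"
    by (simp add: V_L_star_def matrix_vector_mul_assoc)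
  then have "\<And>i. 0 \<le> (Y *v join (V_L_star Y V_S) V_S) $ Inl i"
    by (simp add: mult_join_Inl I_L_star_def)
  from kirchhoff_minimum_at_source[OF Y this] obtain k where k: "\<forall>v. join (V_L_star Y V_S) V_S $ Inr k \<le> join (V_L_star Y V_S) V_S $ v"
    by blast
  from k[rule_format, of "Inl i"] V[of k] show ?thesis by simp
qed

theorem lemma4p9:
  fixes Y :: "real^('n::finite + 'm::finite)^('n + 'm)"
    and V_S :: "real^'m"
    and p q :: ereal
  assumes "kirchhoff_matrix Y"
    and "irreducible_matrix (block_LL Y)"
    and "\<forall>j. 0 < V_S $ j"
    and "1 \<le> p" and "1 \<le> q" and "1 / p + 1 / q = 1"
  defines "V \<equiv> diag_matrix (V_L_star Y V_S)"
  defines "M \<equiv> matrix_inv ((1 / 4) *\<^sub>R (V ** block_LL Y ** V))"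
  defines "r \<equiv> inverse (row_pnorm q M)"
  shows "{P :: real^'n. row_pnorm q M * pnorm p P < 1} = {y. pnorm p y < r}
    \<and> r > 0
    \<and> (\<forall>P :: real^'n. 0 \<le> P \<and> pnorm p P < r \<longrightarrow> pnorm \<infinity> (M *v P) < 1)
    \<and> (\<forall>\<rho>>0. (\<forall>P :: real^'n. 0 \<le> P \<and> pnorm p P < \<rho> \<longrightarrow> pnorm \<infinity> (M *v P) < 1) \<longrightarrow> \<rho> \<le> r)"
proof -
  have "inverse_nonneg ((1 / 4) *\<^sub>R (V ** block_LL Y ** V))"
    unfolding V_def using assms(1,3)
    by (intro inverse_nonneg_diag_scale inverse_nonneg_block_LL V_L_star_pos) auto
  then have "0 \<le> row j M" "row j M \<noteq> 0" for j
    unfolding M_def by (rule inverse_nonneg_rows)+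
  from ball_pnorm_sharp[OF assms(4-6) this] show ?thesis
    unfolding r_def pnorm_infty .
qed

end
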